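(* Let $k\ge 2$ be an integer. For every integer $n\geq 1$, \[ \#B_k(n)=\#E_k(n), \] where $B_k(n)$ is the set of partitions of $n$ in which no part is a multiple of $k$, and $E_k(n)$ is the set of partitions of $n$ whose largest part $m$ is not a multiple of $k$ and in which every part not exceeding $\lfloor m/k\rfloor$ appears at most $k-1$ times.
   Context: A partition of $n$ is a finite non-increasing sequence of positive integers summing to $n$. Partitions in $B_k(n)$ are called $k$-regular partitions. In the definition of $E_k(n)$, parts larger than $\lfloor m/k\rfloor$ (other than the largest part) may be arbitrary positive integers, including multiples of $k$, and may appear any number of times. *)

theory Defs imports Main begin

definition partitions :: "nat \<Rightarrow> nat list set" where
  "partitions n = {xs. sorted_wrt (\<ge>) xs \<and> (\<forall>p\<in>set xs. 0 < p) \<and> sum_list xs = n}"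

definition regular_partitions :: "nat \<Rightarrow> nat \<Rightarrow> nat list set" where
  "regular_partitions k n = {xs \<in> partitions n. \<forall>p\<in>set xs. \<not> k dvd p}"

text \<open>
  The largest part is \<^term>\<open>Max (set xs)\<close>, which is meaningful only for a nonempty
  partition, i.e. for \<open>n \<ge> 1\<close>.
\<close>

definition bounded_small_part_partitions :: "nat \<Rightarrow> nat \<Rightarrow> nat list set" where
  "bounded_small_part_partitions k n =
    {xs \<in> partitions n.
      \<not> k dvd Max (set xs) \<and>
      (\<forall>p\<in>set xs. p \<le> Max (set xs) div k \<longrightarrow> count_list xs p \<le> k - 1)}"

text \<open>
  \<^const>\<open>card\<close> is \<open>0\<close> on infinite sets; the following shows that the sets counted are finite.
\<close>

lemma finite_partitions: "finite (partitions n)"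
proof (rule finite_subset)
  have len: "length xs \<le> sum_list xs" if "\<forall>p\<in>set xs. 0 < p" for xs :: "nat list"
    using that by (induction xs) auto
  show "partitions n \<subseteq> {xs. set xs \<subseteq> {..n} \<and> length xs \<le> n}"
    using len by (auto simp: partitions_def member_le_sum_list)
  show "finite {xs. set xs \<subseteq> {..n} \<and> length xs \<le> n}"
    by (rule finite_lists_length_le) simp
qed

end

theory Submission imports Defs "HOL-Library.Multiset" begin

text \<open>
  The identity holds for each largest part \<open>m\<close> separately. Trading \<open>k\<close> copies of \<open>p\<close> for one copy
  of \<open>k * p\<close> matches the partitions containing \<open>p\<close> at least \<open>k\<close> times with those containing
  \<open>k * p\<close>; passing to complements, forbidding the former amounts to forbidding the latter. Doing
  this for all \<open>p \<le> m div k\<close>, in decreasing order, turns the condition that these parts occur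
  fewer than \<open>k\<close> times into the condition that no multiple of \<open>k\<close> in \<open>{1..m}\<close> occurs. Since \<open>m\<close> is
  not a multiple of \<open>k\<close> and \<open>m > m div k\<close>, the largest part is never touched.
\<close>

text \<open>Keeping the allowed parts \<open>S\<close> apart from the capped parts \<open>D\<close>
  lets one trade drop \<open>p\<close> from \<open>D\<close> and \<open>k * p\<close> from
  \<open>S\<close>. Here \<open>m\<close> merely occurs; it is the largest part once
  \<open>S\<close> lies in \<open>{..m}\<close>.\<close>

definition restricted_msets :: "nat \<Rightarrow> nat set \<Rightarrow> nat set \<Rightarrow> nat \<Rightarrow> nat \<Rightarrow> nat multiset set" where
  "restricted_msets k S D m n =
    {M. set_mset M \<subseteq> S \<and> (\<forall>d\<in>D. count M d < k) \<and> m \<in># M \<and> \<Sum>\<^sub># M = n}"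

lemma inj_on_mset_partitions: "inj_on mset (partitions n)"
proof (rule inj_onI)
  fix xs ys assume *: "xs \<in> partitions n" "ys \<in> partitions n" "mset xs = mset ys"
  \<comment> \<open>Partitions are listed in non-increasing order, so reversal gives the order that
    \<open>sort\<close> fixes.\<close>
  then have "sort (rev xs) = sort (rev ys)"
    by (metis mset_rev sorted_list_of_multiset_mset)
  moreover have "sorted (rev xs)" "sorted (rev ys)"
    using * by (simp_all add: partitions_def sorted_wrt_rev)
  ultimately have "rev xs = rev ys"
    by (simp add: sorted_sort_id)
  then show "xs = ys" by simp
qed

lemma mset_image_partitions: "mset ` partitions n = {M. 0 \<notin># M \<and> \<Sum>\<^sub># M = n}"
proof (intro equalityI subsetI)
  fix M :: "nat multiset" assume "M \<in> {M. 0 \<notin># M \<and> \<Sum>\<^sub># M = n}"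
  then have M: "0 \<notin># M" "\<Sum>\<^sub># M = n" by auto
  let ?xs = "rev (sorted_list_of_multiset M)"
  have mset_xs: "mset ?xs = M" by simp
  have "sum_list ?xs = n"
    using M(2) by (metis mset_xs sum_mset_sum_list)
  moreover have "sorted_wrt (\<ge>) ?xs"
    by (simp add: sorted_wrt_rev)
  ultimately have "?xs \<in> partitions n"
    using M(1) by (auto simp: partitions_def intro: gr0I)
  then show "M \<in> mset ` partitions n"
    using mset_xs by (metis imageI)
qed (auto simp: partitions_def sum_mset_sum_list)

lemma finite_restricted_msets:
  assumes "0 \<notin> S" shows "finite (restricted_msets k S D m n)"
proof (rule finite_subset)
  show "restricted_msets k S D m n \<subseteq> mset ` partitions n"
    using assms by (auto simp: restricted_msets_def mset_image_partitions)
qed (simp add: finite_partitions)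

text \<open>The traded parts have equal sums, and the opposite trade is the inverse. Only the
  multiplicities of \<open>p\<close> and \<open>k * p\<close> change; as neither lies in
  \<open>D\<close> or equals \<open>m\<close>, the caps and the presence of \<open>m\<close>
  survive.\<close>

lemma bij_betw_trade:
  assumes "k \<ge> 2" "p > 0" "p \<in> S" "k * p \<in> S" "p \<notin> D" "k * p \<notin> D" "p \<noteq> m" "k * p \<noteq> m"
  shows "bij_betw (\<lambda>M. M - replicate_mset k p + {#k * p#})
    {M \<in> restricted_msets k S D m n. k \<le> count M p} {M \<in> restricted_msets k S D m n. k * p \<in># M}"
proof (rule bij_betw_byWitness[where f' = "\<lambda>M. M - {#k * p#} + replicate_mset k p"])
  have ne: "k * p \<noteq> p" using assms by simp
  show "(\<lambda>M. M - replicate_mset k p + {#k * p#}) ` {M \<in> restricted_msets k S D m n. k \<le> count M p}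
    \<subseteq> {M \<in> restricted_msets k S D m n. k * p \<in># M}"
  proof clarify
    fix M assume M: "M \<in> restricted_msets k S D m n" "k \<le> count M p"
    \<comment> \<open>Splitting off the copies to be traded turns truncated subtraction into exact
      cancellation.\<close>
    then obtain N where N: "M = N + replicate_mset k p"
      by (metis count_le_replicate_mset_subset_eq subset_mset.diff_add)
    show "M - replicate_mset k p + {#k * p#} \<in> restricted_msets k S D m n
      \<and> k * p \<in># M - replicate_mset k p + {#k * p#}"
      using M assms ne unfolding N restricted_msets_def by (auto simp: sum_mset_replicate_mset)
  qed
  show "(\<lambda>M. M - {#k * p#} + replicate_mset k p) ` {M \<in> restricted_msets k S D m n. k * p \<in># M}
    \<subseteq> {M \<in> restricted_msets k S D m n. k \<le> count M p}"
  proof clarify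
    fix M assume M: "M \<in> restricted_msets k S D m n" "k * p \<in># M"
    then obtain N where N: "M = N + {#k * p#}"
      by (metis insert_DiffM2)
    show "M - {#k * p#} + replicate_mset k p \<in> restricted_msets k S D m n
      \<and> k \<le> count (M - {#k * p#} + replicate_mset k p) p"
      using M assms ne unfolding N restricted_msets_def
      by (auto simp: sum_mset_replicate_mset split: if_splits)
  qed
qed (auto simp: count_le_replicate_mset_subset_eq subset_mset.diff_add)

text \<open>Both sides are complements in the same set, finite because \<open>0 \<notin> S\<close>,
  and the trade shows that the removed subsets have equal size.\<close>

lemma card_restricted_msets_insert:
  assumes "k \<ge> 2" "0 \<notin> S" "p \<in> S" "k * p \<in> S" "p \<notin> D" "k * p \<notin> D" "p \<noteq> m" "k * p \<noteq> m"
  shows "card (restricted_msets k S (insert p D) m n) = card (restricted_msets k (S - {k * p}) D m n)"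
proof -
  let ?R = "restricted_msets k S D m n"
  have fin: "finite ?R" using assms by (simp add: finite_restricted_msets)
  have "p > 0" using assms by (metis gr0I)
  then have "card {M \<in> ?R. k \<le> count M p} = card {M \<in> ?R. k * p \<in># M}"
    using assms by (intro bij_betw_same_card[OF bij_betw_trade]) auto
  then have "card (?R - {M \<in> ?R. k \<le> count M p}) = card (?R - {M \<in> ?R. k * p \<in># M})"
    using fin by (simp add: card_Diff_subset)
  moreover have "?R - {M \<in> ?R. k \<le> count M p} = restricted_msets k S (insert p D) m n"
    by (auto simp: restricted_msets_def)
  moreover have "?R - {M \<in> ?R. k * p \<in># M} = restricted_msets k (S - {k * p}) D m n"
    by (auto simp: restricted_msets_def)
  ultimately show ?thesis by simp
qed

text \<open>The induction adds a new maximum \<open>p\<close> to \<open>D\<close>, so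
  \<open>k * p > p\<close> lies outside \<open>D\<close>, as a single trade requires.
  \<open>S\<close> varies because each trade deletes an element from it.\<close>

lemma card_restricted_msets_eq:
  assumes "finite D" "k \<ge> 2" "0 \<notin> S" "D \<subseteq> S" "(*) k ` D \<subseteq> S" "m \<notin> D" "m \<notin> (*) k ` D"
  shows "card (restricted_msets k S D m n) = card (restricted_msets k (S - (*) k ` D) {} m n)"
  using assms
proof (induction D arbitrary: S rule: finite_linorder_max_induct)
  case (insert p D)
  have "p > 0" using insert.prems by (metis gr0I insertI1 subsetD)
  then have "p < k * p" using insert.prems by simp
  then have notin: "p \<notin> D" "k * p \<notin> D" using insert.hyps(2) by (auto dest: less_trans)
  have "card (restricted_msets k S (insert p D) m n) = card (restricted_msets k (S - {k * p}) D m n)"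
    using insert.prems notin by (intro card_restricted_msets_insert) auto
  \<comment> \<open>The smaller \<open>S - {k * p}\<close> still contains \<open>D\<close>, since
    \<open>k * p \<notin> D\<close>, and each \<open>k * d\<close> with \<open>d\<close> in
    \<open>D\<close>, since \<open>d \<noteq> p\<close>.\<close>
  also have "\<dots> = card (restricted_msets k (S - {k * p} - (*) k ` D) {} m n)"
    using insert.prems notin by (intro insert.IH) auto
  also have "S - {k * p} - (*) k ` D = S - (*) k ` insert p D"
    by auto
  finally show ?case .
qed simp

lemma card_by_Max:
  assumes "A \<subseteq> partitions n" "n \<ge> 1"
  shows "card A = (\<Sum>m\<le>n. card {xs \<in> A. Max (set xs) = m})"
proof -
  have "Max (set xs) \<le> n" if "xs \<in> A" for xs
  proof -
    have xs: "xs \<in> partitions n" using that assms by auto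
    \<comment> \<open>A positive \<open>n\<close> rules out the empty list, where \<open>Max\<close>
      has no meaningful value.\<close>
    then have "xs \<noteq> []" using assms by (auto simp: partitions_def)
    then have "Max (set xs) \<in> set xs" by simp
    then show ?thesis using xs by (auto simp: partitions_def member_le_sum_list)
  qed
  then have "(\<lambda>xs. Max (set xs)) ` A \<subseteq> {..n}" by auto
  moreover have "finite A" using assms finite_partitions finite_subset by blast
  ultimately show ?thesis
    using sum.group[of A "{..n}" "\<lambda>xs. Max (set xs)" "\<lambda>_. 1::nat"] by simp
qed

text \<open>As \<open>mset\<close> is injective on partitions, lists may be counted as multisets.
  Membership in \<open>A\<close> is described only for largest part \<open>m\<close>, so
  \<open>S\<close> and \<open>D\<close> may depend on \<open>m\<close>.\<close>

lemma card_eq_card_restricted_msets: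
  assumes "n \<ge> 1" "0 \<notin> S" "S \<subseteq> {..m}" "A \<subseteq> partitions n"
    and "\<And>xs. xs \<in> partitions n \<Longrightarrow> Max (set xs) = m \<Longrightarrow>
      xs \<in> A \<longleftrightarrow> set xs \<subseteq> S \<and> (\<forall>d\<in>D. count_list xs d < k)"
  shows "card {xs \<in> A. Max (set xs) = m} = card (restricted_msets k S D m n)"
proof -
  have "inj_on mset {xs \<in> A. Max (set xs) = m}"
    using assms by (auto intro: inj_on_subset[OF inj_on_mset_partitions])
  moreover have "mset ` {xs \<in> A. Max (set xs) = m} = restricted_msets k S D m n"
  proof (intro equalityI subsetI)
    fix M assume "M \<in> mset ` {xs \<in> A. Max (set xs) = m}"
    then obtain xs where xs: "M = mset xs" "xs \<in> A" "Max (set xs) = m" by auto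
    then have part: "xs \<in> partitions n" using assms by auto
    then have "set xs \<noteq> {}" using assms by (auto simp: partitions_def)
    then have "m \<in> set xs" using xs Max_in by blast
    then show "M \<in> restricted_msets k S D m n"
      using xs part assms(5)[OF part xs(3)]
      by (auto simp: restricted_msets_def partitions_def count_mset sum_mset_sum_list)
  next
    fix M assume M: "M \<in> restricted_msets k S D m n"
    then have "M \<in> mset ` partitions n"
      using assms by (auto simp: mset_image_partitions restricted_msets_def)
    then obtain xs where xs: "M = mset xs" "xs \<in> partitions n" by auto
    have *: "set xs \<subseteq> S" "m \<in> set xs" "\<forall>d\<in>D. count_list xs d < k"
      using M xs by (auto simp: restricted_msets_def count_mset)
    have "Max (set xs) = m"
      using * assms by (intro Max_eqI) auto
    then show "M \<in> mset ` {xs \<in> A. Max (set xs) = m}"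
      using xs * assms(5) by auto
  qed
  ultimately show ?thesis by (metis card_image)
qed

lemma card_Max_eq:
  assumes "k \<ge> 2" "n \<ge> 1"
  shows "card {xs \<in> regular_partitions k n. Max (set xs) = m}
    = card {xs \<in> bounded_small_part_partitions k n. Max (set xs) = m}"
proof (cases "k dvd m")
  case True
  \<comment> \<open>If \<open>k\<close> divides \<open>m\<close>, both sides are empty: on the left
    \<open>m\<close> would itself be a forbidden part, on the right the definition excludes
    it.\<close>
  have "Max (set xs) \<in> set xs" if "xs \<in> partitions n" for xs
    using that assms by (intro Max_in) (auto simp: partitions_def)
  with True have "{xs \<in> regular_partitions k n. Max (set xs) = m} = {}"
    by (force simp: regular_partitions_def)
  moreover have "{xs \<in> bounded_small_part_partitions k n. Max (set xs) = m} = {}"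
    using True by (auto simp: bounded_small_part_partitions_def)
  ultimately show ?thesis by (simp only:)
next
  case False
  let ?D = "{1..m div k}"
  have "m > 0" using False by (auto intro: gr0I)
  then have lt: "m div k < m" using assms by simp
  \<comment> \<open>Since \<open>k * i \<le> m\<close> iff \<open>i \<le> m div k\<close>, the
    trades over \<open>?D\<close> remove exactly the parts that \<open>k\<close>-regularity
    forbids.\<close>
  have mult: "(*) k ` ?D = {j \<in> {1..m}. k dvd j}"
  proof (intro equalityI subsetI)
    fix j assume "j \<in> {j \<in> {1..m}. k dvd j}"
    then obtain i where "j = k * i" "1 \<le> j" "j \<le> m" by auto
    moreover from this have "i \<in> ?D"
      using assms by (auto simp: less_eq_div_iff_mult_less_eq mult.commute)
    ultimately show "j \<in> (*) k ` ?D" by blast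
  qed (use assms in \<open>auto simp: less_eq_div_iff_mult_less_eq mult.commute\<close>)
  have bound: "set xs \<subseteq> {1..m}" if "xs \<in> partitions n" "Max (set xs) = m" for xs
    using that by (auto simp: partitions_def Suc_le_eq)
  have "card {xs \<in> regular_partitions k n. Max (set xs) = m}
    = card (restricted_msets k ({1..m} - (*) k ` ?D) {} m n)"
  proof (intro card_eq_card_restricted_msets)
    fix xs assume xs: "xs \<in> partitions n" "Max (set xs) = m"
    show "xs \<in> regular_partitions k n \<longleftrightarrow>
      set xs \<subseteq> {1..m} - (*) k ` ?D \<and> (\<forall>d\<in>{}. count_list xs d < k)"
      using bound[OF xs] xs unfolding mult regular_partitions_def by auto
  qed (use assms in \<open>auto simp: regular_partitions_def\<close>)
  also have "\<dots> = card (restricted_msets k {1..m} ?D m n)"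
  proof (rule card_restricted_msets_eq[symmetric])
    show "(*) k ` ?D \<subseteq> {1..m}" "m \<notin> (*) k ` ?D" using False by (auto simp only: mult)
  qed (use assms lt in auto)
  also have "\<dots> = card {xs \<in> bounded_small_part_partitions k n. Max (set xs) = m}"
  proof (intro card_eq_card_restricted_msets[symmetric])
    fix xs assume xs: "xs \<in> partitions n" "Max (set xs) = m"
    \<comment> \<open>An element of \<open>?D\<close> that is not a part has count
      \<open>0 < k\<close>; conversely, parts are positive, so those up to \<open>m div k\<close>
      lie in \<open>?D\<close>.\<close>
    have "(\<forall>p\<in>set xs. p \<le> m div k \<longrightarrow> count_list xs p \<le> k - 1) \<longleftrightarrow> (\<forall>d\<in>?D. count_list xs d < k)"
    proof (intro iffI ballI impI)
      fix d assume "\<forall>p\<in>set xs. p \<le> m div k \<longrightarrow> count_list xs p \<le> k - 1" "d \<in> ?D"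
      then show "count_list xs d < k"
        using assms by (cases "d \<in> set xs") (force simp: count_list_0_iff)+
    next
      fix p assume "\<forall>d\<in>?D. count_list xs d < k" "p \<in> set xs" "p \<le> m div k"
      then show "count_list xs p \<le> k - 1"
        using bound[OF xs] by (force simp: less_eq_Suc_le)
    qed
    then show "xs \<in> bounded_small_part_partitions k n \<longleftrightarrow>
      set xs \<subseteq> {1..m} \<and> (\<forall>d\<in>?D. count_list xs d < k)"
      using bound[OF xs] xs False by (simp add: bounded_small_part_partitions_def)
  qed (use assms in \<open>auto simp: bounded_small_part_partitions_def\<close>)
  finally show ?thesis .
qed

theorem theorem1p3:
  fixes k n :: nat
  assumes "k \<ge> 2" and "n \<ge> 1"
  shows "card (regular_partitions k n) = card (bounded_small_part_partitions k n)"
proof -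
  have "regular_partitions k n \<subseteq> partitions n" "bounded_small_part_partitions k n \<subseteq> partitions n"
    by (auto simp: regular_partitions_def bounded_small_part_partitions_def)
  \<comment> \<open>The two sums over the largest part agree term by term.\<close>
  then show ?thesis
    using assms by (simp add: card_by_Max card_Max_eq)
qed

end
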